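(* Let $\mathcal{M}$ be a simple matroid polytope of rank $r$ on the ground set $E=\{e_1,\dotsc,e_n\}$. For the linear ordering $e_1\prec e_2\prec\cdots\prec e_n$ of $E$, the following two statements are equivalent: (1) $e_1\prec\cdots\prec e_n$ is a K-ordering of $\mathcal{M}$; (2) $\Xi(e_1)\prec\Xi(e_2)\prec\cdots\prec\Xi(e_n)$ is a shelling of the boundary $\partial T(\mathcal{M})$ of the tope $T(\mathcal{M})$, i.e. for every pair of indices $i<j$ such that some facet of $\mathcal{M}$ contains both $e_i$ and $e_j$, there is an index $\ell<j$ such that the set $\mathcal{H}(e_\ell,e_j)$ of facets of $\mathcal{M}$ containing both $e_\ell$ and $e_j$ has exactly $r-2$ elements and $\mathcal{H}(e_i,e_j)\subseteq\mathcal{H}(e_\ell,e_j)$.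
   Context: An oriented matroid $\mathcal{M}$ on $E$ is acyclic if it has no positive circuit. A face of an acyclic oriented matroid is a subset $F\subseteq E$ such that there is a covector $Y$ of $\mathcal{M}$ with $Y\ge 0$ and zero set $Y^0=F$; its rank is its rank in the underlying matroid. A facet is a face of rank $r-1$. $\mathcal{M}$ is a matroid polytope if it is acyclic and every element $e\in E$ is extreme, i.e. $\{e\}$ is a face (of rank 1). The graph $G(\mathcal{M})$ has vertex set $E$ (the rank-1 faces) and an edge $\{u,v\}$ for each rank-2 face $\{u,v\}$. For a face $F$, $G(F)$ is the subgraph induced on $F$ (vertices the elements of $F$, edges the rank-2 faces contained in $F$). $\mathcal{M}$ is simple if every vertex of $G(\mathcal{M})$ lies on exactly $r-1$ edges. Given a linear ordering $\prec$ of $E$, $G_\prec(F)$ is the digraph obtained by orienting every edge $\{u,v\}$ of $G(F)$ from $u$ to $v$ when $v\prec u$; a sink is a vertex with no outgoing edge. The ordering is a K-ordering if for every non-empty face $F$ of $\mathcal{M}$ the digraph $G_\prec(F)$ has exactly one sink. The tope $T(\mathcal{M})$ is the cell of the topological representation of acyclic reorientations corresponding to $\mathcal{M}$; for simple $\mathcal{M}$ its boundary is an abstract simplicial complex whose vertices are $\Xi(H)$ for the facets $H$ of $\mathcal{M}$ and whose maximal cells are $\Xi(e)$, $e\in E$, where $\Xi(e)$ has vertex set $\{\Xi(H): H \text{ a facet of } \mathcal{M},\ e\in H\}$; thus $\Xi(e_i)\cap\Xi(e_j)$ corresponds to $\mathcal{H}(e_i,e_j)$, and the shelling condition is as stated in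 (2).
   Formalization: In (2) the shelling condition is required for every pair i<j, not only for pairs contained in a common facet; with that restriction the equivalence fails for r=3 (quadrilateral a,b,c,d in cyclic order, ordered a≺c≺b≺d). *)

theory Defs
  imports Main
begin

text \<open>A sign vector on \<open>E\<close> is a function into \<open>{-1, 0, 1}\<close> that vanishes outside \<open>E\<close>, so that
  equality of sign vectors is equality of functions.\<close>

definition sign_vector :: "'a set \<Rightarrow> ('a \<Rightarrow> int) \<Rightarrow> bool" where
  "sign_vector E X \<longleftrightarrow> (\<forall>e\<in>E. X e \<in> {-1, 0, 1}) \<and> (\<forall>e. e \<notin> E \<longrightarrow> X e = 0)"

definition support :: "('a \<Rightarrow> int) \<Rightarrow> 'a set" where
  "support X = {e. X e \<noteq> 0}"

definition sign_comp :: "('a \<Rightarrow> int) \<Rightarrow> ('a \<Rightarrow> int) \<Rightarrow> 'a \<Rightarrow> int" where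
  "sign_comp X Y = (\<lambda>e. if X e \<noteq> 0 then X e else Y e)"

definition separation :: "('a \<Rightarrow> int) \<Rightarrow> ('a \<Rightarrow> int) \<Rightarrow> 'a set" where
  "separation X Y = {e. X e \<noteq> 0 \<and> X e = - Y e}"

definition sign_orthogonal :: "('a \<Rightarrow> int) \<Rightarrow> ('a \<Rightarrow> int) \<Rightarrow> bool" where
  "sign_orthogonal X Y \<longleftrightarrow>
     (\<forall>e. X e * Y e = 0) \<or> (\<exists>e f. X e * Y e > 0 \<and> X f * Y f < 0)"

text \<open>An oriented matroid on the finite ground set \<open>E\<close>, given by its set \<open>L\<close> of covectors
  (zero, symmetry, composition and elimination axioms).\<close>

locale oriented_matroid =
  fixes E :: "'a set" and L :: "('a \<Rightarrow> int) set"
  assumes finite_ground: "finite E"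
    and covector_sign_vector: "Y \<in> L \<Longrightarrow> sign_vector E Y"
    and zero_covector: "(\<lambda>_. 0) \<in> L"
    and uminus_covector: "Y \<in> L \<Longrightarrow> (\<lambda>e. - Y e) \<in> L"
    and comp_covector: "Y \<in> L \<Longrightarrow> Z \<in> L \<Longrightarrow> sign_comp Y Z \<in> L"
    and elimination: "Y \<in> L \<Longrightarrow> Z \<in> L \<Longrightarrow> e \<in> separation Y Z \<Longrightarrow>
      \<exists>W\<in>L. W e = 0 \<and> (\<forall>f\<in>E - separation Y Z. W f = sign_comp Y Z f)"

definition om_vector :: "'a set \<Rightarrow> ('a \<Rightarrow> int) set \<Rightarrow> ('a \<Rightarrow> int) \<Rightarrow> bool" where
  "om_vector E L X \<longleftrightarrow> sign_vector E X \<and> (\<forall>Y\<in>L. sign_orthogonal X Y)"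

definition circuit :: "'a set \<Rightarrow> ('a \<Rightarrow> int) set \<Rightarrow> ('a \<Rightarrow> int) \<Rightarrow> bool" where
  "circuit E L X \<longleftrightarrow> om_vector E L X \<and> support X \<noteq> {} \<and>
     (\<forall>Z. om_vector E L Z \<and> support Z \<noteq> {} \<longrightarrow> \<not> support Z \<subset> support X)"

definition acyclic_om :: "'a set \<Rightarrow> ('a \<Rightarrow> int) set \<Rightarrow> bool" where
  "acyclic_om E L \<longleftrightarrow> \<not> (\<exists>X. circuit E L X \<and> (\<forall>e\<in>E. X e \<ge> 0))"

text \<open>The underlying matroid is the one whose flats are the zero sets of the covectors; the closure
  of \<open>A\<close> is therefore the intersection of the zero sets that contain \<open>A\<close>.\<close>

definition om_closure :: "'a set \<Rightarrow> ('a \<Rightarrow> int) set \<Rightarrow> 'a set \<Rightarrow> 'a set" where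
  "om_closure E L A = {e \<in> E. \<forall>Y\<in>L. (\<forall>a\<in>A. Y a = 0) \<longrightarrow> Y e = 0}"

definition om_indep :: "'a set \<Rightarrow> ('a \<Rightarrow> int) set \<Rightarrow> 'a set \<Rightarrow> bool" where
  "om_indep E L A \<longleftrightarrow> A \<subseteq> E \<and> (\<forall>a\<in>A. a \<notin> om_closure E L (A - {a}))"

definition om_rank :: "'a set \<Rightarrow> ('a \<Rightarrow> int) set \<Rightarrow> 'a set \<Rightarrow> nat" where
  "om_rank E L A = Max {card I | I. I \<subseteq> A \<and> om_indep E L I}"

text \<open>The zero covector makes \<open>E\<close> itself a face.\<close>

definition face :: "'a set \<Rightarrow> ('a \<Rightarrow> int) set \<Rightarrow> 'a set \<Rightarrow> bool" where
  "face E L F \<longleftrightarrow> (\<exists>Y\<in>L. (\<forall>e\<in>E. Y e \<ge> 0) \<and> F = {e \<in> E. Y e = 0})"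

definition facet :: "'a set \<Rightarrow> ('a \<Rightarrow> int) set \<Rightarrow> 'a set \<Rightarrow> bool" where
  "facet E L F \<longleftrightarrow> face E L F \<and> om_rank E L F + 1 = om_rank E L E"

definition matroid_polytope :: "'a set \<Rightarrow> ('a \<Rightarrow> int) set \<Rightarrow> bool" where
  "matroid_polytope E L \<longleftrightarrow> oriented_matroid E L \<and> acyclic_om E L \<and>
     (\<forall>e\<in>E. face E L {e} \<and> om_rank E L {e} = 1)"

text \<open>The edges of the graph \<open>G(F)\<close>, whose vertex set is \<open>F\<close>; the graph of the matroid polytope
  is the case \<open>F = E\<close>. A set \<open>{u, v}\<close> of rank 2 has \<open>u \<noteq> v\<close>.\<close>

definition graph_edges :: "'a set \<Rightarrow> ('a \<Rightarrow> int) set \<Rightarrow> 'a set \<Rightarrow> 'a set set" where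
  "graph_edges E L F =
     {{u, v} | u v. {u, v} \<subseteq> F \<and> face E L {u, v} \<and> om_rank E L {u, v} = 2}"

definition simple_om :: "'a set \<Rightarrow> ('a \<Rightarrow> int) set \<Rightarrow> bool" where
  "simple_om E L \<longleftrightarrow> (\<forall>v\<in>E. card {d \<in> graph_edges E L E. v \<in> d} = om_rank E L E - 1)"

text \<open>Here \<open>prec\<close> is a strict linear ordering of \<open>E\<close>; edges point to their smaller end.\<close>

definition graph_arcs ::
    "'a set \<Rightarrow> ('a \<Rightarrow> int) set \<Rightarrow> ('a \<Rightarrow> 'a \<Rightarrow> bool) \<Rightarrow> 'a set \<Rightarrow> ('a \<times> 'a) set" where
  "graph_arcs E L prec F = {(u, v). {u, v} \<in> graph_edges E L F \<and> prec v u}"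

definition is_sink :: "'a set \<Rightarrow> ('a \<times> 'a) set \<Rightarrow> 'a \<Rightarrow> bool" where
  "is_sink V A v \<longleftrightarrow> v \<in> V \<and> (\<forall>w. (v, w) \<notin> A)"

definition K_ordering :: "'a set \<Rightarrow> ('a \<Rightarrow> int) set \<Rightarrow> ('a \<Rightarrow> 'a \<Rightarrow> bool) \<Rightarrow> bool" where
  "K_ordering E L prec \<longleftrightarrow>
     (\<forall>F. face E L F \<and> F \<noteq> {} \<longrightarrow> (\<exists>!v. is_sink F (graph_arcs E L prec F) v))"

definition index_prec :: "(nat \<Rightarrow> 'a) \<Rightarrow> nat \<Rightarrow> 'a \<Rightarrow> 'a \<Rightarrow> bool" where
  "index_prec e n u v \<longleftrightarrow> (\<exists>i j. 1 \<le> i \<and> i < j \<and> j \<le> n \<and> u = e i \<and> v = e j)"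

text \<open>The facets that contain both \<open>u\<close> and \<open>v\<close>, i.e. the vertex set of \<open>\<Xi>(u) \<inter> \<Xi>(v)\<close> in the
  boundary complex of the tope.\<close>

definition common_facets :: "'a set \<Rightarrow> ('a \<Rightarrow> int) set \<Rightarrow> 'a \<Rightarrow> 'a \<Rightarrow> 'a set set" where
  "common_facets E L u v = {H. facet E L H \<and> u \<in> H \<and> v \<in> H}"

text \<open>\<open>\<Xi>(e 1), \<dots>, \<Xi>(e n)\<close> is a shelling of the boundary complex of the tope, which is pure of
  dimension \<open>r - 2\<close>, so that a ridge has \<open>r - 2\<close> vertices. As usual for shellings, the
  condition is imposed on all pairs \<open>i < j\<close>, including those for which the two cells are disjoint.
  Imposing it only when they meet would, in rank 3, accept every ordering of the vertices of a
  quadrilateral, although an ordering that begins with two opposite vertices neither shells the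
  boundary nor has a single sink on the quadrilateral.\<close>

definition tope_boundary_shelling ::
    "'a set \<Rightarrow> ('a \<Rightarrow> int) set \<Rightarrow> (nat \<Rightarrow> 'a) \<Rightarrow> nat \<Rightarrow> bool" where
  "tope_boundary_shelling E L e n \<longleftrightarrow>
     (\<forall>i j. 1 \<le> i \<and> i < j \<and> j \<le> n \<longrightarrow>
        (\<exists>l. 1 \<le> l \<and> l < j \<and>
             card (common_facets E L (e l) (e j)) = om_rank E L E - 2 \<and>
             common_facets E L (e i) (e j) \<subseteq> common_facets E L (e l) (e j)))"

text \<open>The condition on disjoint cells amounts to each later cell meeting an earlier one in a ridge.\<close>

lemma tope_boundary_shelling_iff:
  "tope_boundary_shelling E L e n \<longleftrightarrow>
     (\<forall>i j. 1 \<le> i \<and> i < j \<and> j \<le> n \<and> (\<exists>H. facet E L H \<and> e i \<in> H \<and> e j \<in> H) \<longrightarrow>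
        (\<exists>l. 1 \<le> l \<and> l < j \<and>
             card (common_facets E L (e l) (e j)) = om_rank E L E - 2 \<and>
             common_facets E L (e i) (e j) \<subseteq> common_facets E L (e l) (e j))) \<and>
     (\<forall>j. 2 \<le> j \<and> j \<le> n \<longrightarrow>
        (\<exists>l. 1 \<le> l \<and> l < j \<and> card (common_facets E L (e l) (e j)) = om_rank E L E - 2))"
    (is "?S \<longleftrightarrow> ?A \<and> ?B")
proof
  assume S: ?S
  have ?A using S unfolding tope_boundary_shelling_def by blast
  moreover have ?B
  proof (intro allI impI)
    fix j :: nat assume "2 \<le> j \<and> j \<le> n"
    then have "1 \<le> (1::nat) \<and> 1 < j \<and> j \<le> n" by simp
    then show "\<exists>l. 1 \<le> l \<and> l < j \<and> card (common_facets E L (e l) (e j)) = om_rank E L E - 2"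
      using S unfolding tope_boundary_shelling_def by blast
  qed
  ultimately show "?A \<and> ?B" ..
next
  assume AB: "?A \<and> ?B"
  show ?S unfolding tope_boundary_shelling_def
  proof (intro allI impI)
    fix i j :: nat assume ij: "1 \<le> i \<and> i < j \<and> j \<le> n"
    show "\<exists>l. 1 \<le> l \<and> l < j \<and>
             card (common_facets E L (e l) (e j)) = om_rank E L E - 2 \<and>
             common_facets E L (e i) (e j) \<subseteq> common_facets E L (e l) (e j)"
    proof (cases "common_facets E L (e i) (e j) = {}")
      case True
      have "2 \<le> j \<and> j \<le> n" using ij by simp
      with AB True show ?thesis by blast
    next
      case False
      then have "\<exists>H. facet E L H \<and> e i \<in> H \<and> e j \<in> H"
        unfolding common_facets_def by blast
      with AB ij show ?thesis by blast
    qed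
  qed
qed

end

theory Submission
  imports Defs
begin

text \<open>In a simple matroid polytope the vertex figure at \<open>v\<close> has as many walls as its rank, hence it
  is a simplex: its \<open>r - 1\<close> walls are the edges at \<open>v\<close>, and each facet at \<open>v\<close> misses exactly one
  neighbour of \<open>v\<close>. As every face is the intersection of the facets containing it, \<open>u\<close> and \<open>v\<close>
  have exactly \<open>r - 2\<close> common facets iff \<open>{u, v}\<close> is an edge. The shelling condition for \<open>i < j\<close>
  thus asks for an earlier neighbour of \<open>e j\<close> in the smallest face containing \<open>e i\<close> and \<open>e j\<close>,
  while the K-condition asks the same for every face that contains both.\<close>

context oriented_matroid
begin

section \<open>Covectors and the closure operator\<close>

lemma covector_outside: "Y \<in> L \<Longrightarrow> x \<notin> E \<Longrightarrow> Y x = 0"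
  using covector_sign_vector unfolding sign_vector_def by blast

lemma covector_cases:
  assumes "Y \<in> L" obtains "Y x = -1" | "Y x = 0" | "Y x = 1"
  using covector_sign_vector[OF assms] unfolding sign_vector_def by blast

lemma subset_finite: "A \<subseteq> E \<Longrightarrow> finite A"
  using finite_subset[OF _ finite_ground] .

lemma separation_subset: "Y \<in> L \<Longrightarrow> separation Y Z \<subseteq> E"
  using covector_outside unfolding separation_def by blast

lemma finite_separation: "Y \<in> L \<Longrightarrow> finite (separation Y Z)"
  using subset_finite[OF separation_subset] .

lemma closure_extensive: "A \<subseteq> E \<Longrightarrow> A \<subseteq> om_closure E L A"
  unfolding om_closure_def by blast

lemma closure_subset_ground: "om_closure E L A \<subseteq> E"
  unfolding om_closure_def by blast

lemma closure_minimal: "A \<subseteq> om_closure E L B \<Longrightarrow> om_closure E L A \<subseteq> om_closure E L B"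
  unfolding om_closure_def by blast

lemma closure_mono: "A \<subseteq> B \<Longrightarrow> om_closure E L A \<subseteq> om_closure E L B"
  unfolding om_closure_def by blast

text \<open>Otherwise some covector \<open>Y\<close> vanishes on \<open>A\<close> and
  \<open>x\<close> but not at \<open>y\<close>, while some \<open>Z\<close> vanishes on
  \<open>A\<close> but not at \<open>x\<close>, hence not at \<open>y\<close> either. Eliminating
  \<open>y\<close> between them leaves a covector that vanishes on \<open>A\<close> and
  \<open>y\<close> but keeps the value \<open>Z x\<close>.\<close>

lemma closure_exchange:
  assumes x: "x \<in> om_closure E L (insert y A)" "x \<notin> om_closure E L A" and y: "y \<in> E"
  shows "y \<in> om_closure E L (insert x A)"
proof (rule ccontr)
  assume "y \<notin> om_closure E L (insert x A)"
  then obtain Y where Y: "Y \<in> L" "\<forall>a\<in>A. Y a = 0" "Y x = 0" "Y y \<noteq> 0"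
    using y unfolding om_closure_def by auto
  obtain Z where Z: "Z \<in> L" "\<forall>a\<in>A. Z a = 0" "Z x \<noteq> 0"
    using x unfolding om_closure_def by auto
  have Zy: "Z y \<noteq> 0" using x(1) Z unfolding om_closure_def by auto
  \<comment> \<open>Nonzero signs at \<open>y\<close> are equal or opposite, so \<open>Y\<close> or
    its negative is opposite to \<open>Z\<close> there.\<close>
  obtain Y' where Y': "Y' \<in> L" "\<forall>a\<in>A. Y' a = 0" "Y' x = 0" "Y' y = - Z y"
  proof (cases "Y y = - Z y")
    case True with Y that show thesis by blast
  next
    case False
    then have "- Y y = - Z y"
      using Y(4) Zy by (cases rule: covector_cases[OF Y(1), of y]; cases rule: covector_cases[OF Z(1), of y]) auto
    with Y uminus_covector[OF Y(1)] that[of "\<lambda>e. - Y e"] show thesis by simp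
  qed
  have "y \<in> separation Y' Z" using Y' Zy unfolding separation_def by simp
  then obtain W where W: "W \<in> L" "W y = 0" "\<forall>f\<in>E - separation Y' Z. W f = sign_comp Y' Z f"
    using elimination[OF Y'(1) Z(1)] by blast
  have "W a = 0" if "a \<in> A" for a
    using that W Y' Z covector_outside[OF W(1), of a] unfolding separation_def sign_comp_def
    by (cases "a \<in> E") auto
  moreover have "W x = Z x"
    using W Y' Z x(1) unfolding separation_def sign_comp_def om_closure_def by auto
  ultimately show False using x(1) W Z(3) unfolding om_closure_def by auto
qed

section \<open>Independence and rank in the underlying matroid\<close>

lemma indep_subset: "om_indep E L I \<Longrightarrow> J \<subseteq> I \<Longrightarrow> om_indep E L J"
  unfolding om_indep_def using closure_mono[of "J - {_}" "I - {_}"] by blast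

lemma indep_insert:
  assumes I: "om_indep E L I" and x: "x \<in> E" "x \<notin> om_closure E L I"
  shows "om_indep E L (insert x I)"
  unfolding om_indep_def
proof (intro conjI ballI)
  show "insert x I \<subseteq> E" using I x unfolding om_indep_def by blast
  have xI: "x \<notin> I" using x I closure_extensive[of I] unfolding om_indep_def by blast
  fix a assume a: "a \<in> insert x I"
  show "a \<notin> om_closure E L (insert x I - {a})"
  proof (cases "a = x")
    case True then show ?thesis using x xI by simp
  next
    case False
    then have aI: "a \<in> I" and eq: "insert x I - {a} = insert x (I - {a})" using a by auto
    show ?thesis
    proof
      assume "a \<in> om_closure E L (insert x I - {a})"
      then have "x \<in> om_closure E L (insert a (I - {a}))"
        using closure_exchange[of a x "I - {a}"] eq aI I x(1) unfolding om_indep_def by auto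
      then show False using x(2) aI by (simp add: insert_absorb)
    qed
  qed
qed

text \<open>Steinitz exchange: elements of \<open>I\<close> outside \<open>S\<close> are traded one
  by one for elements of \<open>S\<close>, which keeps the cardinality and shrinks
  \<open>I - S\<close>.\<close>

lemma card_indep_le_card_spanning:
  assumes "om_indep E L I" "S \<subseteq> E" "I \<subseteq> om_closure E L S"
  shows "card I \<le> card S"
  using assms
proof (induction "card (I - S)" arbitrary: I rule: less_induct)
  case less
  have finI: "finite I" and finS: "finite S"
    using less.prems subset_finite unfolding om_indep_def by auto
  show ?case
  proof (cases "I \<subseteq> S")
    case True then show ?thesis using card_mono finS by blast
  next
    case False
    then obtain x where x: "x \<in> I" "x \<notin> S" by blast
    have nx: "x \<notin> om_closure E L (I - {x})" using less.prems x unfolding om_indep_def by blast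
    \<comment> \<open>Otherwise the closure of \<open>S\<close>, and with it \<open>x\<close>, would
      lie in the closure of \<open>I - {x}\<close>.\<close>
    have "\<not> S \<subseteq> om_closure E L (I - {x})"
      using closure_minimal[of S "I - {x}"] nx less.prems(3) x(1) by blast
    then obtain s where s: "s \<in> S" "s \<notin> om_closure E L (I - {x})" by blast
    let ?J = "insert s (I - {x})"
    have J: "om_indep E L ?J"
      using indep_insert[of "I - {x}" s] indep_subset[OF less.prems(1)] s less.prems(2) by blast
    have "I - {x} \<subseteq> E" using less.prems(1) unfolding om_indep_def by blast
    then have sI: "s \<notin> I - {x}" using s closure_extensive by blast
    have "?J - S = (I - S) - {x}" using s by blast
    then have "card (?J - S) < card (I - S)"
      using x finI by (metis DiffI card_Diff1_less finite_Diff)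
    moreover have "?J \<subseteq> om_closure E L S"
      using less.prems closure_extensive[of S] s by blast
    ultimately have "card ?J \<le> card S" using less.hyps[OF _ J less.prems(2)] by blast
    moreover have "card ?J = card I"
      using sI finI x(1) by (metis card_Suc_Diff1 card_insert_disjoint finite_Diff)
    ultimately show ?thesis by simp
  qed
qed

lemma rank_set_finite: "A \<subseteq> E \<Longrightarrow> finite {card I | I. I \<subseteq> A \<and> om_indep E L I}"
proof -
  assume "A \<subseteq> E"
  then have "finite (Pow A)" using subset_finite by simp
  then have "finite (card ` Pow A)" by blast
  then show ?thesis by (rule rev_finite_subset) auto
qed

lemma card_le_rank:
  "A \<subseteq> E \<Longrightarrow> I \<subseteq> A \<Longrightarrow> om_indep E L I \<Longrightarrow> card I \<le> om_rank E L A"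
  unfolding om_rank_def by (rule Max_ge[OF rank_set_finite]) auto

lemma rank_attained:
  assumes "A \<subseteq> E"
  obtains I where "I \<subseteq> A" "om_indep E L I" "card I = om_rank E L A"
proof -
  have "om_indep E L {}" unfolding om_indep_def by simp
  then have "{card I | I. I \<subseteq> A \<and> om_indep E L I} \<noteq> {}" by blast
  then have "om_rank E L A \<in> {card I | I. I \<subseteq> A \<and> om_indep E L I}"
    unfolding om_rank_def using Max_in[OF rank_set_finite[OF assms]] by blast
  with that show thesis by auto
qed

lemma rank_mono: "A \<subseteq> B \<Longrightarrow> B \<subseteq> E \<Longrightarrow> om_rank E L A \<le> om_rank E L B"
  by (metis rank_attained card_le_rank order.trans)

lemma rank_le_card_spanning:
  assumes "S \<subseteq> E" "A \<subseteq> om_closure E L S"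
  shows "om_rank E L A \<le> card S"
proof -
  have "A \<subseteq> E" using assms(2) closure_subset_ground by blast
  then obtain I where "I \<subseteq> A" "om_indep E L I" "card I = om_rank E L A" by (rule rank_attained)
  then show ?thesis using card_indep_le_card_spanning[of I S] assms by auto
qed

lemma rank_insert_gt:
  assumes "A \<subseteq> E" "x \<in> E" "x \<notin> om_closure E L A"
  shows "om_rank E L A + 1 \<le> om_rank E L (insert x A)"
proof -
  obtain I where I: "I \<subseteq> A" "om_indep E L I" "card I = om_rank E L A"
    using rank_attained[OF assms(1)] .
  have x: "x \<notin> om_closure E L I" using closure_mono[OF I(1)] assms(3) by blast
  have "x \<notin> I" using I(1) closure_extensive[OF assms(1)] assms(3) by blast
  moreover have "finite I" using subset_finite[OF subset_trans[OF I(1) assms(1)]] .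
  ultimately have "card (insert x I) = om_rank E L A + 1" using I(3) by simp
  then show ?thesis
    using card_le_rank[of "insert x A" "insert x I"] indep_insert[OF I(2) assms(2) x] I(1) assms
    by auto
qed

text \<open>A largest independent subset \<open>I\<close> of \<open>A\<close> spans
  \<open>A\<close>, so \<open>insert x I\<close> spans everything in the closure on the
  left.\<close>

lemma rank_insert_le:
  assumes "A \<subseteq> E" "x \<in> E"
  shows "om_rank E L (om_closure E L (insert x A)) \<le> om_rank E L A + 1"
proof -
  obtain I where I: "I \<subseteq> A" "om_indep E L I" "card I = om_rank E L A"
    using rank_attained[OF assms(1)] .
  have finI: "finite I" using subset_finite[OF subset_trans[OF I(1) assms(1)]] .
  have "A \<subseteq> om_closure E L I"
  proof (rule ccontr)
    assume "\<not> A \<subseteq> om_closure E L I"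
    then obtain a where a: "a \<in> A" "a \<notin> om_closure E L I" by blast
    have "a \<notin> I" using a I closure_extensive[of I] unfolding om_indep_def by blast
    then have "card (insert a I) = om_rank E L A + 1" using I(3) finI by simp
    moreover have "card (insert a I) \<le> om_rank E L A"
      using card_le_rank[OF assms(1)] indep_insert[OF I(2) _ a(2)] a I(1) assms(1) by blast
    ultimately show False by simp
  qed
  then have "insert x A \<subseteq> om_closure E L (insert x I)"
    using closure_mono[of I "insert x I"] closure_extensive[of "insert x I"] I(1) assms by blast
  then have "om_rank E L (om_closure E L (insert x A)) \<le> card (insert x I)"
    using rank_le_card_spanning[of "insert x I"] closure_minimal[of "insert x A"] I(1) assms by auto
  also have "\<dots> \<le> om_rank E L A + 1" using I(3) finI by (simp add: card_insert_if)
  finally show ?thesis .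
qed

text \<open>A dependent spanning set could drop an element and still span, with fewer elements than
  the rank.\<close>

lemma spanning_imp_indep:
  assumes "S \<subseteq> E" "E \<subseteq> om_closure E L S" "card S \<le> om_rank E L E"
  shows "om_indep E L S"
proof (rule ccontr)
  assume "\<not> om_indep E L S"
  then obtain a where a: "a \<in> S" "a \<in> om_closure E L (S - {a})"
    using assms(1) unfolding om_indep_def by blast
  have "S \<subseteq> om_closure E L (S - {a})"
    using closure_extensive[of "S - {a}"] a assms(1) by blast
  then have "om_rank E L E \<le> card (S - {a})"
    using rank_le_card_spanning[of "S - {a}" E] closure_minimal assms by blast
  moreover have "card (S - {a}) < card S"
    using a(1) subset_finite[OF assms(1)] by (rule card_Diff1_less[rotated])
  ultimately show False using assms(3) by simp
qed

text \<open>The segment from \<open>X\<close> towards \<open>Z\<close> leaves the nonnegative orthant at \<open>W\<close>.\<close>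

lemma nonneg_elimination:
  assumes X: "X \<in> L" "\<forall>x. X x \<ge> 0"
    and "Z \<in> L" "\<forall>x. X x = 0 \<longrightarrow> Z x \<ge> 0" "separation X Z \<noteq> {}"
  shows "\<exists>W\<in>L. (\<forall>x. W x \<ge> 0) \<and> (\<exists>x\<in>separation X Z. W x = 0) \<and>
    (\<forall>x. x \<notin> separation X Z \<longrightarrow> W x = sign_comp X Z x)"
  using assms(3-)
proof (induction "card (separation X Z)" arbitrary: Z rule: less_induct)
  case less
  obtain a where a: "a \<in> separation X Z" using less.prems by blast
  obtain V where V: "V \<in> L" "V a = 0" "\<forall>f\<in>E - separation X Z. V f = sign_comp X Z f"
    using elimination[OF X(1) less.prems(1) a] by blast
  have Veq: "V x = sign_comp X Z x" if "x \<notin> separation X Z" for x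
    using that V covector_outside[OF V(1), of x] covector_outside[OF X(1), of x]
      covector_outside[OF less.prems(1), of x]
    unfolding sign_comp_def by (cases "x \<in> E") auto
  \<comment> \<open>Off \<open>separation X Z\<close> the covector \<open>V\<close> is the
    composition, which is never opposite to \<open>X\<close>; at \<open>a\<close> it is 0. The
    separation set therefore shrinks strictly, and the induction continues with \<open>V\<close> in
    place of \<open>Z\<close>.\<close>
  have sub: "separation X V \<subseteq> separation X Z"
  proof
    fix x assume "x \<in> separation X V"
    then show "x \<in> separation X Z"
      using Veq[of x] by (cases "x \<in> separation X Z") (auto simp: separation_def sign_comp_def)
  qed
  moreover have "a \<notin> separation X V" using V(2) unfolding separation_def by auto
  ultimately have lt: "card (separation X V) < card (separation X Z)"
    using a by (intro psubset_card_mono[OF finite_separation[OF X(1)]]) blast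
  have V0: "\<forall>x. X x = 0 \<longrightarrow> V x \<ge> 0"
    using Veq less.prems(2) by (simp add: separation_def sign_comp_def)
  show ?case
  proof (cases "separation X V = {}")
    case True
    have "V x \<ge> 0" for x
    proof (cases "X x = 0")
      case False
      then have "V x \<noteq> - X x" using True unfolding separation_def by force
      then show ?thesis using False X(2)[rule_format, of x]
        by (cases rule: covector_cases[OF V(1), of x]; cases rule: covector_cases[OF X(1), of x]) auto
    qed (use V0 in blast)
    then show ?thesis using V Veq a by blast
  next
    case False
    obtain W where W: "W \<in> L" "\<forall>x. W x \<ge> 0" "\<exists>x\<in>separation X V. W x = 0"
      "\<forall>x. x \<notin> separation X V \<longrightarrow> W x = sign_comp X V x"
      using less.hyps[OF lt V(1) V0 False] by blast
    have "W x = sign_comp X Z x" if "x \<notin> separation X Z" for x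
      using that W(4) Veq sub unfolding sign_comp_def by (metis subsetD)
    then show ?thesis using W sub by blast
  qed
qed

section \<open>Faces and facets\<close>

lemma face_iff: "face E L F \<longleftrightarrow> (\<exists>Y\<in>L. (\<forall>x. Y x \<ge> 0) \<and> F = {x \<in> E. Y x = 0})"
  unfolding face_def using covector_outside by (metis order.refl)

lemma face_subset: "face E L F \<Longrightarrow> F \<subseteq> E"
  unfolding face_def by blast

lemma face_ground: "face E L E"
  unfolding face_iff using zero_covector by auto

lemma face_Int:
  assumes "face E L F" "face E L G"
  shows "face E L (F \<inter> G)"
proof -
  obtain Y Z where Y: "Y \<in> L" "\<forall>x. Y x \<ge> 0" "F = {x \<in> E. Y x = 0}"
    and Z: "Z \<in> L" "\<forall>x. Z x \<ge> 0" "G = {x \<in> E. Z x = 0}"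
    using assms unfolding face_iff by blast
  have "F \<inter> G = {x \<in> E. sign_comp Y Z x = 0}" "\<forall>x. sign_comp Y Z x \<ge> 0"
    using Y Z unfolding sign_comp_def by auto
  then show ?thesis unfolding face_iff using comp_covector[OF Y(1) Z(1)] by blast
qed

text \<open>The factor \<open>E\<close> takes care of the empty family, whose intersection is the
  whole type.\<close>

lemma face_Inter:
  assumes "finite \<F>" "\<forall>F\<in>\<F>. face E L F"
  shows "face E L (E \<inter> \<Inter>\<F>)"
  using assms
proof (induction rule: finite_induct)
  case empty then show ?case using face_ground by simp
next
  case (insert F \<F>)
  then have "face E L (F \<inter> (E \<inter> \<Inter>\<F>))" using face_Int by blast
  then show ?case by (simp add: Int_left_commute)
qed

lemma face_closed:
  assumes "face E L F" shows "om_closure E L F = F"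
proof -
  obtain Y where Y: "Y \<in> L" "F = {x \<in> E. Y x = 0}" using assms unfolding face_iff by blast
  then have "om_closure E L F \<subseteq> F" unfolding om_closure_def by blast
  then show ?thesis using closure_extensive face_subset[OF assms] by blast
qed

lemma facet_properties:
  assumes "facet E L H"
  shows "face E L H" "H \<subset> E" "om_rank E L H + 1 = om_rank E L E"
  using assms face_subset unfolding facet_def by auto

lemma finite_facets: "finite {H. facet E L H}"
proof (rule finite_subset)
  show "{H. facet E L H} \<subseteq> Pow E" using facet_properties by blast
qed (use finite_ground in simp)

text \<open>Faces are flats, so an element of \<open>F\<close> outside \<open>H\<close> would raise
  the rank of \<open>F\<close> above that of \<open>H\<close>.\<close>

lemma facet_subset_eq:
  assumes H: "facet E L H" and F: "facet E L F" and sub: "H \<subseteq> F"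
  shows "H = F"
proof (rule ccontr)
  assume "H \<noteq> F"
  then obtain x where x: "x \<in> F" "x \<notin> H" using sub by blast
  have "om_rank E L H + 1 \<le> om_rank E L (insert x H)"
    using rank_insert_gt[of H x] x face_closed facet_properties[OF H] facet_properties[OF F] by blast
  also have "\<dots> \<le> om_rank E L F"
    using rank_mono[of "insert x H" F] x sub facet_properties[OF F] by blast
  finally show False using facet_properties[OF H] facet_properties[OF F] by simp
qed

text \<open>Since \<open>H\<close> is a flat, adding \<open>x\<close> raises the rank; since the
  result spans, the rank is raised by exactly one.\<close>

lemma facetI:
  assumes H: "face E L H" and x: "x \<in> E" "x \<notin> H"
    and span: "E \<subseteq> om_closure E L (insert x H)"
  shows "facet E L H"
proof -
  have sub: "H \<subseteq> E" using face_subset[OF H] .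
  have "om_rank E L H + 1 \<le> om_rank E L E"
    using rank_insert_gt[OF sub x(1)] face_closed[OF H] x sub rank_mono[of "insert x H" E] by force
  moreover have "om_rank E L E \<le> om_rank E L H + 1"
    using rank_insert_le[OF sub x(1)] span closure_subset_ground[of "insert x H"] by (simp add: subset_antisym)
  ultimately show ?thesis using H unfolding facet_def by simp
qed

text \<open>A nonnegative covector that is minimal among those positive at a given element is a cocircuit.\<close>

lemma face_separated_by_facet:
  assumes F: "face E L F" and x: "x \<in> E" "x \<notin> F"
  shows "\<exists>H. facet E L H \<and> F \<subseteq> H \<and> x \<notin> H"
proof -
  define \<F> where "\<F> = {G. face E L G \<and> F \<subseteq> G \<and> x \<notin> G}"
  have "\<F> \<subseteq> Pow E" using face_subset unfolding \<F>_def by blast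
  then have "finite \<F>" by (rule finite_subset) (simp add: finite_ground)
  moreover have "F \<in> \<F>" using F x unfolding \<F>_def by blast
  ultimately obtain H where H: "H \<in> \<F>" "\<And>G. G \<in> \<F> \<Longrightarrow> H \<subseteq> G \<Longrightarrow> G = H"
    using finite_has_maximal2[of \<F> F] by (metis (no_types, lifting))
  have fH: "face E L H" "F \<subseteq> H" "x \<notin> H" using H(1) unfolding \<F>_def by auto
  obtain X where X: "X \<in> L" "\<forall>x. X x \<ge> 0" "H = {x \<in> E. X x = 0}"
    using fH unfolding face_iff by blast
  \<comment> \<open>Moving from \<open>X\<close> towards such a \<open>Z\<close> would reach a
    nonnegative covector that still vanishes on \<open>H\<close>, is nonzero at \<open>x\<close> and
    has a further zero, against the maximality of \<open>H\<close>.\<close>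
  have step: False if Z: "Z \<in> L" "\<forall>y\<in>H. Z y = 0" "Z x = 0" "separation X Z \<noteq> {}" for Z
  proof -
    have "\<forall>y. X y = 0 \<longrightarrow> Z y \<ge> 0" using Z X covector_outside by (metis (mono_tags, lifting) mem_Collect_eq order.refl)
    then obtain W where W: "W \<in> L" "\<forall>y. W y \<ge> 0" "\<exists>y\<in>separation X Z. W y = 0"
      "\<forall>y. y \<notin> separation X Z \<longrightarrow> W y = sign_comp X Z y"
      using nonneg_elimination[OF X(1,2) Z(1) _ Z(4)] by blast
    have "X x \<noteq> 0" using X x fH by blast
    then have "W x \<noteq> 0" using W(4) Z(3) by (auto simp: separation_def sign_comp_def)
    moreover have "W y = 0" if "y \<in> H" for y
      using that W(4) Z(2) X(3) by (auto simp: separation_def sign_comp_def)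
    ultimately have "{y \<in> E. W y = 0} \<in> \<F>" "H \<subseteq> {y \<in> E. W y = 0}"
      using W fH X(3) unfolding \<F>_def face_iff by auto
    then have "{y \<in> E. W y = 0} = H" using H(2) by blast
    moreover obtain y where "y \<in> separation X Z" "W y = 0" using W(3) by blast
    ultimately show False using X(3) separation_subset[OF X(1)] unfolding separation_def by blast
  qed
  \<comment> \<open>At a nonzero value, \<open>X\<close> is opposite to \<open>Z\<close> or to its
    negative, and \<open>step\<close> excludes both. So \<open>insert x H\<close> spans.\<close>
  have "Z y = 0" if Z: "Z \<in> L" "\<forall>y\<in>H. Z y = 0" "Z x = 0" for Z y
  proof (rule ccontr)
    assume y: "Z y \<noteq> 0"
    then have "X y \<noteq> 0" using Z(2) X(3) covector_outside[OF Z(1)] by blast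
    then have "X y = - Z y \<or> X y = Z y"
      using y by (cases rule: covector_cases[OF Z(1), of y]; cases rule: covector_cases[OF X(1), of y]) auto
    then have "y \<in> separation X Z \<or> y \<in> separation X (\<lambda>e. - Z e)"
      using \<open>X y \<noteq> 0\<close> unfolding separation_def by auto
    then show False using step[OF Z] step[OF uminus_covector[OF Z(1)]] Z by auto
  qed
  then have "E \<subseteq> om_closure E L (insert x H)" unfolding om_closure_def by auto
  then have "facet E L H" using facetI[OF fH(1) x(1) fH(3)] by blast
  then show ?thesis using fH by blast
qed

end

section \<open>Vertices, edges and vertex figures of a simple matroid polytope\<close>

definition neighbours :: "'a set \<Rightarrow> ('a \<Rightarrow> int) set \<Rightarrow> 'a \<Rightarrow> 'a set" where
  "neighbours E L v = {w \<in> E. w \<noteq> v \<and> face E L {v, w}}"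

locale simple_polytope = oriented_matroid +
  assumes extreme: "v \<in> E \<Longrightarrow> face E L {v}"
    and rank_vertex: "v \<in> E \<Longrightarrow> om_rank E L {v} = 1"
    and simple: "simple_om E L"
begin

text \<open>Acts as an interior point of the vertex figure at \<open>v\<close>: it is the starting
  point for \<open>nonneg_elimination\<close> below.\<close>

lemma vertex_covector:
  assumes "v \<in> E"
  obtains Y where "Y \<in> L" "Y v = 0" "\<And>x. x \<in> E \<Longrightarrow> x \<noteq> v \<Longrightarrow> Y x = 1" "\<forall>x. Y x \<ge> 0"
proof -
  obtain Y where Y: "Y \<in> L" "\<forall>x. Y x \<ge> 0" "{v} = {x \<in> E. Y x = 0}"
    using extreme[OF assms] unfolding face_iff by blast
  have "Y x = 1" if "x \<in> E" "x \<noteq> v" for x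
    using that Y(3) Y(2)[rule_format, of x] by (cases rule: covector_cases[OF Y(1), of x]) auto
  with Y that show thesis by blast
qed

text \<open>On a minimal face properly containing \<open>v\<close>, a covector of the contraction at \<open>v\<close> that
  separates two further elements would cut off a smaller such face.\<close>

lemma face_contains_edge:
  assumes F: "face E L F" and v: "v \<in> F" "F \<noteq> {v}"
  shows "\<exists>w\<in>F. w \<in> neighbours E L v"
proof -
  define \<F> where "\<F> = {G. face E L G \<and> G \<subseteq> F \<and> v \<in> G \<and> G \<noteq> {v}}"
  have "\<F> \<subseteq> Pow E" using face_subset unfolding \<F>_def by blast
  then have "finite \<F>" by (rule finite_subset) (simp add: finite_ground)
  moreover have "F \<in> \<F>" using F v unfolding \<F>_def by blast
  ultimately obtain G where G: "G \<in> \<F>" "\<And>D. D \<in> \<F> \<Longrightarrow> D \<subseteq> G \<Longrightarrow> D = G"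
    using finite_has_minimal2[of \<F> F] by (metis (no_types, lifting))
  have fG: "face E L G" "G \<subseteq> F" "v \<in> G" "G \<noteq> {v}" using G(1) unfolding \<F>_def by auto
  have GE: "G \<subseteq> E" using face_subset[OF fG(1)] .
  obtain w where w: "w \<in> G" "w \<noteq> v" using fG by blast
  have "G = {v, w}"
  proof (rule ccontr)
    assume "G \<noteq> {v, w}"
    then obtain w' where w': "w' \<in> G" "w' \<noteq> v" "w' \<noteq> w" using fG w by blast
    have inE: "v \<in> E" "w \<in> E" "w' \<in> E" using GE fG(3) w w' by auto
    obtain X where X: "X \<in> L" "X v = 0" "\<And>x. x \<in> E \<Longrightarrow> x \<noteq> v \<Longrightarrow> X x = 1" "\<forall>x. X x \<ge> 0"
      using vertex_covector[OF inE(1)] by blast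
    obtain A where A: "A \<in> L" "A w = 0" "\<And>x. x \<in> E \<Longrightarrow> x \<noteq> w \<Longrightarrow> A x = 1"
      using vertex_covector[OF inE(2)] by blast
    obtain B where B: "B \<in> L" "B w' = 0" "\<And>x. x \<in> E \<Longrightarrow> x \<noteq> w' \<Longrightarrow> B x = 1"
      using vertex_covector[OF inE(3)] by blast
    \<comment> \<open>Both \<open>A\<close> and \<open>B\<close> are 1 at \<open>v\<close>.
      Eliminating \<open>v\<close> between \<open>A\<close> and \<open>- B\<close> thus gives a
      covector \<open>Z\<close> that is 0 at \<open>v\<close>, -1 at \<open>w\<close> and 1 at
      \<open>w'\<close>.\<close>
    let ?B = "\<lambda>x. - B x"
    have "v \<in> separation A ?B" using A B w w' inE unfolding separation_def by auto
    then obtain Z where Z: "Z \<in> L" "Z v = 0" "\<forall>x\<in>E - separation A ?B. Z x = sign_comp A ?B x"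
      using elimination[OF A(1) uminus_covector[OF B(1)]] by blast
    have "w \<notin> separation A ?B" using A(2) unfolding separation_def by simp
    then have Zw: "Z w = -1" using Z(3) inE A(2) B(3) w'(3) unfolding sign_comp_def by auto
    have "w' \<notin> separation A ?B" using B(2) unfolding separation_def by auto
    then have Zw': "Z w' = 1" using Z(3) inE A(3) w'(3) unfolding sign_comp_def by auto
    obtain Y where Y: "Y \<in> L" "\<forall>x. Y x \<ge> 0" "G = {x \<in> E. Y x = 0}"
      using fG(1) unfolding face_iff by blast
    \<comment> \<open>Composing with \<open>Y\<close> makes the covector positive off
      \<open>G\<close> and leaves \<open>Z\<close> on \<open>G\<close>, so that no new zero can
      arise outside \<open>G\<close>.\<close>
    let ?U = "sign_comp Y Z"
    have U_in: "?U x = Z x" if "x \<in> G" for x using that Y(3) unfolding sign_comp_def by auto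
    have U_out: "?U x > 0" if "x \<in> E" "x \<notin> G" for x
      using that Y(3) Y(2)[rule_format, of x] unfolding sign_comp_def by auto
    have "\<forall>x. X x = 0 \<longrightarrow> ?U x \<ge> 0"
    proof (intro allI impI)
      fix x assume "X x = 0"
      then consider "x = v" | "x \<notin> E" using X(3)[of x] by fastforce
      then show "?U x \<ge> 0"
        using U_in[OF fG(3)] Z(2) covector_outside[OF comp_covector[OF Y(1) Z(1)], of x] by cases auto
    qed
    moreover have "w \<in> separation X ?U"
      using X(3)[OF inE(2) w(2)] U_in[OF w(1)] Zw unfolding separation_def by simp
    ultimately obtain W where W: "W \<in> L" "\<forall>x. W x \<ge> 0" "\<exists>x\<in>separation X ?U. W x = 0"
      "\<forall>x. x \<notin> separation X ?U \<longrightarrow> W x = sign_comp X ?U x"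
      using nonneg_elimination[OF X(1,4) comp_covector[OF Y(1) Z(1)]] by blast
    obtain y where y: "y \<in> separation X ?U" "W y = 0" using W(3) by blast
    have yE: "y \<in> E" using y(1) separation_subset[OF X(1)] by blast
    have yv: "y \<noteq> v" using y(1) X(2) unfolding separation_def by auto
    have off: "W x \<noteq> 0" if "x \<in> E" "x \<noteq> v" "?U x > 0" for x
    proof -
      have "x \<notin> separation X ?U" using that X(3)[of x] unfolding separation_def by auto
      then show ?thesis using W(4) X(3)[of x] that unfolding sign_comp_def by auto
    qed
    have Wv: "W v = 0"
      using W(4) X(2) U_in[OF fG(3)] Z(2) by (auto simp: separation_def sign_comp_def)
    \<comment> \<open>This face lies in \<open>G\<close> and contains \<open>v\<close> and
      \<open>y\<close>, so minimality makes it equal to \<open>G\<close>; but \<open>Z\<close> is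
      positive at \<open>w'\<close>, which it therefore misses.\<close>
    let ?D = "{x \<in> E. W x = 0}"
    have "face E L ?D" unfolding face_iff using W by blast
    moreover have sub: "?D \<subseteq> G" using off U_out fG(3) by blast
    moreover have "v \<in> ?D" "?D \<noteq> {v}" using Wv inE y yE yv by auto
    ultimately have "?D = G" using G(2) fG(2) unfolding \<F>_def by blast
    moreover have "W w' \<noteq> 0" using off[OF inE(3) w'(2)] U_in[OF w'(1)] Zw' by simp
    ultimately show False using w'(1) by blast
  qed
  then show ?thesis using fG GE w unfolding neighbours_def by blast
qed

text \<open>The vertex figure at \<open>v\<close> is bounded by the walls belonging to the edges at \<open>v\<close>.\<close>

lemma nonneg_on_neighbours:
  assumes v: "v \<in> E" and Z: "Z \<in> L" "Z v = 0" "\<forall>w\<in>neighbours E L v. Z w \<ge> 0"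
  shows "Z x \<ge> 0"
proof (rule ccontr)
  assume neg: "\<not> Z x \<ge> 0"
  obtain X where X: "X \<in> L" "X v = 0" "\<And>x. x \<in> E \<Longrightarrow> x \<noteq> v \<Longrightarrow> X x = 1" "\<forall>x. X x \<ge> 0"
    using vertex_covector[OF v] by blast
  have "x \<in> E" "x \<noteq> v" using neg Z(2) covector_outside[OF Z(1), of x] by auto
  then have "x \<in> separation X Z"
    using neg X(3)[of x] unfolding separation_def by (cases rule: covector_cases[OF Z(1), of x]) auto
  moreover have "\<forall>y. X y = 0 \<longrightarrow> Z y \<ge> 0"
    using X(3) Z(2) covector_outside[OF Z(1)] by (metis order.refl zero_neq_one)
  ultimately obtain W where W: "W \<in> L" "\<forall>x. W x \<ge> 0" "\<exists>x\<in>separation X Z. W x = 0"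
      "\<forall>x. x \<notin> separation X Z \<longrightarrow> W x = sign_comp X Z x"
    using nonneg_elimination[OF X(1,4) Z(1)] by blast
  obtain y where y: "y \<in> separation X Z" "W y = 0" using W(3) by blast
  have yE: "y \<in> E" using y(1) separation_subset[OF X(1)] by blast
  have yv: "y \<noteq> v" using y(1) X(2) unfolding separation_def by auto
  have Wv: "W v = 0" using W(4) X(2) Z(2) by (auto simp: separation_def sign_comp_def)
  \<comment> \<open>This face contains \<open>v\<close> and \<open>y\<close>, hence an edge from
    \<open>v\<close> to some \<open>w\<close>. As \<open>Z w\<close> is nonnegative,
    \<open>w\<close> is not separating, so \<open>W w\<close> keeps the value 1 of
    \<open>X w\<close>, although \<open>w\<close> is a zero of \<open>W\<close>.\<close>
  let ?D = "{x \<in> E. W x = 0}"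
  have "face E L ?D" unfolding face_iff using W by blast
  moreover have "v \<in> ?D" "?D \<noteq> {v}" using Wv v y yE yv by auto
  ultimately obtain w where w: "w \<in> ?D" "w \<in> neighbours E L v" using face_contains_edge by blast
  have "w \<in> E" "w \<noteq> v" using w unfolding neighbours_def by auto
  then have Xw: "X w = 1" using X(3) by blast
  moreover have "w \<notin> separation X Z" using Xw Z(3) w(2) unfolding separation_def by auto
  ultimately have "W w = 1" using W(4) unfolding sign_comp_def by auto
  with w(1) show False by simp
qed

text \<open>Each vertex is a flat, so neither of the two lies in the closure of the other.\<close>

lemma rank_pair:
  assumes "u \<in> E" "v \<in> E" "u \<noteq> v"
  shows "om_rank E L {u, v} = 2"
proof -
  have "u \<notin> om_closure E L {v}" "v \<notin> om_closure E L {u}"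
    using face_closed extreme assms by auto
  then have "om_indep E L {u, v}"
    using assms unfolding om_indep_def by (auto simp: insert_Diff_if)
  then have "2 \<le> om_rank E L {u, v}" using card_le_rank[of "{u, v}" "{u, v}"] assms by auto
  moreover have "om_rank E L {u, v} \<le> 2"
    using rank_le_card_spanning[of "{u, v}" "{u, v}"] closure_extensive[of "{u, v}"] assms by auto
  ultimately show ?thesis by simp
qed

text \<open>The rank condition on edges excludes the degenerate pair \<open>{v, v}\<close>; for
  distinct vertices it is supplied by \<open>rank_pair\<close>.\<close>

lemma graph_edges_iff:
  assumes "F \<subseteq> E" "v \<in> F"
  shows "{v, w} \<in> graph_edges E L F \<longleftrightarrow> w \<in> F \<and> w \<in> neighbours E L v"
proof
  assume "{v, w} \<in> graph_edges E L F"
  then have *: "{v, w} \<subseteq> F" "face E L {v, w}" "om_rank E L {v, w} = 2"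
    unfolding graph_edges_def by (auto simp: doubleton_eq_iff insert_commute)
  have "w \<noteq> v"
  proof
    assume "w = v"
    then have "om_rank E L {v} = 2" using *(3) by simp
    then show False using rank_vertex assms by auto
  qed
  then show "w \<in> F \<and> w \<in> neighbours E L v" using * assms unfolding neighbours_def by auto
next
  assume "w \<in> F \<and> w \<in> neighbours E L v"
  then have "w \<in> F" "w \<in> E" "w \<noteq> v" "face E L {v, w}" unfolding neighbours_def by auto
  then show "{v, w} \<in> graph_edges E L F"
    using rank_pair[of v w] assms unfolding graph_edges_def by blast
qed

lemma card_neighbours:
  assumes v: "v \<in> E"
  shows "card (neighbours E L v) = om_rank E L E - 1"
proof -
  have "{d \<in> graph_edges E L E. v \<in> d} = (\<lambda>w. {v, w}) ` neighbours E L v"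
  proof (intro equalityI subsetI)
    fix d assume d: "d \<in> {d \<in> graph_edges E L E. v \<in> d}"
    then obtain a b where "d = {a, b}" "v \<in> {a, b}" unfolding graph_edges_def by blast
    then obtain w where "d = {v, w}" by (metis insertE insert_commute singletonD)
    then show "d \<in> (\<lambda>w. {v, w}) ` neighbours E L v"
      using d graph_edges_iff[of E v w] v by auto
  next
    fix d assume "d \<in> (\<lambda>w. {v, w}) ` neighbours E L v"
    then obtain w where "w \<in> neighbours E L v" "d = {v, w}" by blast
    then show "d \<in> {d \<in> graph_edges E L E. v \<in> d}"
      using graph_edges_iff[of E v w] v unfolding neighbours_def by auto
  qed
  moreover have "inj_on (\<lambda>w. {v, w}) (neighbours E L v)"
    by (auto simp: inj_on_def doubleton_eq_iff)
  ultimately have "card {d \<in> graph_edges E L E. v \<in> d} = card (neighbours E L v)"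
    by (simp add: card_image)
  then show ?thesis using simple v unfolding simple_om_def by simp
qed

section \<open>The facets through a vertex form the walls of a simplex\<close>

text \<open>A covector vanishing on \<open>B\<close> is nonnegative, and so is its negative, hence
  it is zero and \<open>B\<close> spans. Simplicity bounds the size of \<open>B\<close> by the rank,
  which gives independence.\<close>

lemma neighbours_basis:
  assumes v: "v \<in> E"
  defines "B \<equiv> insert v (neighbours E L v)"
  shows "B \<subseteq> E" "om_indep E L B" "om_closure E L B = E"
proof -
  show BE: "B \<subseteq> E" using v unfolding B_def neighbours_def by blast
  have "Z x = 0" if Z: "Z \<in> L" "\<forall>b\<in>B. Z b = 0" for Z x
  proof -
    have "Z x \<ge> 0" using nonneg_on_neighbours[OF v Z(1)] Z(2) unfolding B_def by simp
    moreover have "- Z x \<ge> 0"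
      using nonneg_on_neighbours[OF v uminus_covector[OF Z(1)]] Z(2) unfolding B_def by simp
    ultimately show ?thesis by simp
  qed
  then show span: "om_closure E L B = E" unfolding om_closure_def by blast
  \<comment> \<open>Makes the natural-number subtraction in \<open>card_neighbours\<close>
    exact.\<close>
  have "1 \<le> om_rank E L E" using rank_vertex[OF v] rank_mono[of "{v}" E] v by simp
  moreover have "finite (neighbours E L v)" using subset_finite[OF BE] unfolding B_def by simp
  ultimately have "card B \<le> om_rank E L E"
    using card_neighbours[OF v] unfolding B_def by (simp add: card_insert_if)
  then show "om_indep E L B" using spanning_imp_indep[OF BE] span by simp
qed

text \<open>Independence of the basis gives a covector that vanishes on all of it except
  \<open>w\<close>. With sign chosen positive at \<open>w\<close>, it is nonnegative on the
  neighbours and hence everywhere.\<close>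

lemma opposite_facet:
  assumes v: "v \<in> E" and w: "w \<in> neighbours E L v"
  obtains H where "facet E L H" "v \<in> H" "w \<notin> H" "neighbours E L v - {w} \<subseteq> H"
proof -
  let ?N = "neighbours E L v"
  note B = neighbours_basis[OF v]
  have wE: "w \<in> E" "w \<noteq> v" using w unfolding neighbours_def by auto
  have "w \<notin> om_closure E L (insert v ?N - {w})" using B(2) w unfolding om_indep_def by blast
  then obtain Y where Y: "Y \<in> L" "\<forall>b\<in>insert v ?N - {w}. Y b = 0" "Y w \<noteq> 0"
    using wE unfolding om_closure_def by blast
  obtain Z where Z: "Z \<in> L" "\<forall>b\<in>insert v ?N - {w}. Z b = 0" "Z w > 0"
  proof (cases "Y w > 0")
    case True with Y that show thesis by blast
  next
    case False
    with Y uminus_covector[OF Y(1)] that[of "\<lambda>x. - Y x"] show thesis by simp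
  qed
  have "\<forall>x\<in>?N. Z x \<ge> 0"
    using Z by (metis DiffI insertCI less_imp_le order.refl singletonD)
  moreover have "Z v = 0" using Z wE by blast
  ultimately have nonneg: "\<forall>x. Z x \<ge> 0" using nonneg_on_neighbours[OF v Z(1)] by blast
  let ?H = "{x \<in> E. Z x = 0}"
  have H: "face E L ?H" unfolding face_iff using Z nonneg by blast
  have sub: "insert v ?N - {w} \<subseteq> ?H" using Z B(1) by blast
  then have "om_closure E L (insert v ?N) \<subseteq> om_closure E L (insert w ?H)"
    by (intro closure_mono) blast
  then have "facet E L ?H" using facetI[OF H wE(1)] Z(3) B(3) by auto
  moreover have "v \<in> ?H" "?N - {w} \<subseteq> ?H" using sub wE(2) by blast+
  moreover have "w \<notin> ?H" using Z(3) by simp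
  ultimately show thesis using that by blast
qed

text \<open>Let \<open>Y\<close> and \<open>Z\<close> define \<open>H\<close> and \<open>K\<close>.
  Eliminating \<open>w\<close> between \<open>Y\<close> and \<open>- Z\<close> gives a covector that
  equals \<open>Y\<close> on \<open>K\<close> and is 0 at \<open>w\<close>, so it is nonnegative on
  the neighbours and hence everywhere. At an element of \<open>H\<close> outside \<open>K\<close> it
  would be -1.\<close>

lemma opposite_facet_unique:
  assumes v: "v \<in> H" "v \<in> K" and w: "w \<in> neighbours E L v" "w \<notin> H" "w \<notin> K"
    and H: "facet E L H" and K: "facet E L K" "neighbours E L v - {w} \<subseteq> K"
  shows "H = K"
proof (rule facet_subset_eq[OF H K(1)], rule subsetI, rule ccontr)
  fix x assume x: "x \<in> H" "x \<notin> K"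
  obtain Y where Y: "Y \<in> L" "\<forall>x. Y x \<ge> 0" "H = {x \<in> E. Y x = 0}"
    using facet_properties(1)[OF H] unfolding face_iff by blast
  obtain Z where Z: "Z \<in> L" "\<forall>x. Z x \<ge> 0" "K = {x \<in> E. Z x = 0}"
    using facet_properties(1)[OF K(1)] unfolding face_iff by blast
  let ?Z = "\<lambda>x. - Z x"
  have wE: "w \<in> E" using w unfolding neighbours_def by blast
  have pos: "V y = 1" if "V \<in> L" "\<forall>x. V x \<ge> 0" "V y \<noteq> 0" for V y
    using that(2)[rule_format, of y] that(3) by (cases rule: covector_cases[OF that(1), of y]) auto
  have "Y w = 1" "Z w = 1" using pos[OF Y(1,2), of w] pos[OF Z(1,2), of w] Y(3) Z(3) w wE by auto
  then have "w \<in> separation Y ?Z" unfolding separation_def by simp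
  then obtain U where U: "U \<in> L" "U w = 0" "\<forall>x\<in>E - separation Y ?Z. U x = sign_comp Y ?Z x"
    using elimination[OF Y(1) uminus_covector[OF Z(1)]] by blast
  have U_K: "U y = Y y" if "y \<in> K" for y
    using that U(3) Z(3) by (auto simp: separation_def sign_comp_def)
  have "U v = 0" using U_K[OF v(2)] v(1) Y(3) by simp
  moreover have "\<forall>y\<in>neighbours E L v. U y \<ge> 0" using U_K U(2) K(2) Y(2) by fastforce
  moreover have "v \<in> E" using v(1) Y(3) by blast
  ultimately have "U x \<ge> 0" using nonneg_on_neighbours[OF _ U(1)] by blast
  moreover have "Z x = 1" "x \<in> E" "Y x = 0" using pos[OF Z(1,2), of x] x Y(3) Z(3) by auto
  then have "U x = -1" using U(3) by (auto simp: separation_def sign_comp_def)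
  ultimately show False by simp
qed

text \<open>A facet is a proper flat, whereas \<open>v\<close> and its neighbours span.\<close>

lemma facet_misses_neighbour:
  assumes "facet E L H" "v \<in> H"
  shows "\<exists>w\<in>neighbours E L v. w \<notin> H"
proof (rule ccontr)
  assume "\<not> ?thesis"
  then have "insert v (neighbours E L v) \<subseteq> H" using assms by blast
  then have "om_closure E L (insert v (neighbours E L v)) \<subseteq> H"
    using closure_mono face_closed facet_properties(1)[OF assms(1)] by metis
  moreover have "v \<in> E" using assms facet_properties(2) by blast
  ultimately show False using neighbours_basis(3) facet_properties(2)[OF assms(1)] by blast
qed

text \<open>The map \<open>h\<close> sends each neighbour to its opposite wall. It is onto because a
  facet through \<open>v\<close> misses some neighbour \<open>w\<close> and then equals
  \<open>h w\<close> by uniqueness.\<close>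

lemma facets_at_vertex:
  assumes v: "v \<in> E"
  obtains h where "bij_betw h (neighbours E L v) {H. facet E L H \<and> v \<in> H}"
    "\<And>w w'. w \<in> neighbours E L v \<Longrightarrow> w' \<in> neighbours E L v \<Longrightarrow> w' \<in> h w \<longleftrightarrow> w' \<noteq> w"
proof -
  let ?N = "neighbours E L v"
  have "\<forall>w\<in>?N. \<exists>H. facet E L H \<and> v \<in> H \<and> w \<notin> H \<and> ?N - {w} \<subseteq> H"
    using opposite_facet[OF v] by metis
  then obtain h where h: "\<And>w. w \<in> ?N \<Longrightarrow> facet E L (h w) \<and> v \<in> h w \<and> w \<notin> h w \<and> ?N - {w} \<subseteq> h w"
    by metis
  have mem: "w' \<in> h w \<longleftrightarrow> w' \<noteq> w" if "w \<in> ?N" "w' \<in> ?N" for w w' using h that by blast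
  then have "inj_on h ?N" unfolding inj_on_def by blast
  moreover have "h ` ?N = {H. facet E L H \<and> v \<in> H}"
  proof (intro equalityI subsetI)
    fix H assume H: "H \<in> {H. facet E L H \<and> v \<in> H}"
    then obtain w where w: "w \<in> ?N" "w \<notin> H" using facet_misses_neighbour by blast
    then have "H = h w" using opposite_facet_unique[of v H "h w" w] h[OF w(1)] H by blast
    then show "H \<in> h ` ?N" using w(1) by blast
  qed (use h in blast)
  ultimately show thesis using that mem unfolding bij_betw_def by blast
qed

lemma common_facets_card_iff:
  assumes v: "v \<in> E" and u: "u \<in> E" "u \<noteq> v"
  shows "card (common_facets E L u v) = om_rank E L E - 2 \<longleftrightarrow> u \<in> neighbours E L v"
proof -
  let ?N = "neighbours E L v"
  obtain h where h: "bij_betw h ?N {H. facet E L H \<and> v \<in> H}"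
    and mem: "\<And>w w'. w \<in> ?N \<Longrightarrow> w' \<in> ?N \<Longrightarrow> w' \<in> h w \<longleftrightarrow> w' \<noteq> w"
    using facets_at_vertex[OF v] by blast
  \<comment> \<open>Indexes the common facets of \<open>u\<close> and \<open>v\<close> by the
    neighbours of \<open>v\<close> to which they are opposite.\<close>
  define M where "M = {w \<in> ?N. u \<in> h w}"
  have "common_facets E L u v = h ` M"
    using h unfolding common_facets_def M_def bij_betw_def by (auto simp: set_eq_iff image_iff)
  moreover have "inj_on h M" using h unfolding M_def bij_betw_def by (auto intro: inj_on_subset)
  ultimately have cardM: "card (common_facets E L u v) = card M" by (simp add: card_image)
  have finN: "finite ?N" by (rule subset_finite) (auto simp: neighbours_def)
  have cardN: "card ?N = om_rank E L E - 1" using card_neighbours[OF v] .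
  \<comment> \<open>Keeps the subtractions of 1 and 2 from the rank exact.\<close>
  have r: "2 \<le> om_rank E L E" using rank_pair[OF u(1) v u(2)] rank_mono[of "{u, v}" E] u v by auto
  show ?thesis
  proof
    assume "u \<in> ?N"
    then have "M = ?N - {u}" using mem unfolding M_def by auto
    then have "card M = card ?N - 1" using \<open>u \<in> ?N\<close> finN by simp
    then show "card (common_facets E L u v) = om_rank E L E - 2" using cardM cardN by simp
  next
    assume "card (common_facets E L u v) = om_rank E L E - 2"
    then have "card M = om_rank E L E - 2" using cardM by simp
    moreover have "M \<subseteq> ?N" unfolding M_def by blast
    ultimately have "card (?N - M) = 1"
      using card_Diff_subset[of M ?N] finite_subset[OF _ finN, of M] cardN r by simp
    then obtain w where w: "?N - M = {w}" by (rule card_1_singletonE)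
    then have wN: "w \<in> ?N" by blast
    \<comment> \<open>Otherwise some facet contains the edge \<open>{v, w}\<close> but not
      \<open>u\<close>. It is opposite to a neighbour other than \<open>w\<close>, which lies in
      \<open>M\<close>, so the facet would contain \<open>u\<close> after all.\<close>
    have "u \<in> {v, w}"
    proof (rule ccontr)
      assume "u \<notin> {v, w}"
      moreover have "face E L {v, w}" using wN unfolding neighbours_def by blast
      ultimately obtain H where H: "facet E L H" "{v, w} \<subseteq> H" "u \<notin> H"
        using face_separated_by_facet u(1) by blast
      then obtain w' where w': "w' \<in> ?N" "H = h w'" using h unfolding bij_betw_def by blast
      have "w' \<noteq> w" using mem[OF w'(1) wN] w' H by blast
      then have "w' \<in> M" using w w'(1) by blast
      then show False using H w' unfolding M_def by blast
    qed
    then show "u \<in> ?N" using u wN by blast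
  qed
qed

text \<open>A facet containing \<open>F\<close> but not \<open>w\<close> would be a common facet of
  \<open>u\<close> and \<open>v\<close> that misses \<open>w\<close>.\<close>

lemma smallest_face_in_facets:
  assumes F: "face E L F"
    and uv: "u \<in> F" "v \<in> F" and sub: "common_facets E L u v \<subseteq> common_facets E L w v" "w \<in> E"
  shows "w \<in> F"
proof (rule ccontr)
  assume "w \<notin> F"
  then obtain H where "facet E L H" "F \<subseteq> H" "w \<notin> H"
    using face_separated_by_facet[OF F] sub by blast
  then show False using uv sub unfolding common_facets_def by blast
qed

text \<open>This is the smallest face containing \<open>u\<close> and \<open>v\<close>; it is
  \<open>E\<close> itself when they share no facet, which corresponds to disjoint cells.\<close>

lemma face_common_facets:
  assumes "u \<in> E" "v \<in> E"
  shows "face E L (E \<inter> \<Inter>(common_facets E L u v))"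
proof (rule face_Inter)
  show "finite (common_facets E L u v)"
    using finite_facets by (rule rev_finite_subset) (auto simp: common_facets_def)
qed (auto simp: common_facets_def facet_def)

end

section \<open>Sinks, K-orderings and the equivalence with shellings\<close>

lemma index_prec_iff:
  assumes "inj_on e {1..n}" "i \<in> {1..n}" "j \<in> {1..n}"
  shows "index_prec e n (e i) (e j) \<longleftrightarrow> i < j"
proof
  assume "index_prec e n (e i) (e j)"
  then obtain k l where kl: "1 \<le> k" "k < l" "l \<le> n" "e i = e k" "e j = e l"
    unfolding index_prec_def by blast
  then have "i = k" "j = l"
    using inj_onD[OF assms(1), of i k] inj_onD[OF assms(1), of j l] assms(2,3) by auto
  with kl show "i < j" by simp
next
  assume "i < j"
  then show "index_prec e n (e i) (e j)" using assms(2,3) unfolding index_prec_def by auto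
qed

text \<open>The first vertex of a face is always a sink, so the K-condition only says that no later
  vertex of the face is one.\<close>

lemma (in simple_polytope) K_ordering_iff:
  assumes e: "bij_betw e {1..n} E"
  shows "K_ordering E L (index_prec e n) \<longleftrightarrow>
    (\<forall>F i j. face E L F \<and> 1 \<le> i \<and> i < j \<and> j \<le> n \<and> e i \<in> F \<and> e j \<in> F \<longrightarrow>
      (\<exists>l. 1 \<le> l \<and> l < j \<and> e l \<in> F \<and> e l \<in> neighbours E L (e j)))"
    (is "_ \<longleftrightarrow> ?R")
proof -
  have inj: "inj_on e {1..n}" and img: "e ` {1..n} = E" using e unfolding bij_betw_def by auto
  \<comment> \<open>Arcs point to smaller indices, so a sink is a vertex with no earlier neighbour
    in \<open>F\<close>.\<close>
  have sink: "is_sink F (graph_arcs E L (index_prec e n) F) (e j) \<longleftrightarrow>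
      (\<forall>l. 1 \<le> l \<and> l < j \<longrightarrow> e l \<notin> F \<or> e l \<notin> neighbours E L (e j))"
    if F: "face E L F" and j: "j \<in> {1..n}" "e j \<in> F" for F j
  proof -
    have arc: "(e j, w) \<in> graph_arcs E L (index_prec e n) F \<longleftrightarrow>
      (\<exists>l. 1 \<le> l \<and> l < j \<and> w = e l \<and> e l \<in> F \<and> e l \<in> neighbours E L (e j))" for w
    proof
      assume "(e j, w) \<in> graph_arcs E L (index_prec e n) F"
      then have *: "w \<in> F" "w \<in> neighbours E L (e j)" "index_prec e n w (e j)"
        using graph_edges_iff[OF face_subset[OF F] j(2)] unfolding graph_arcs_def by auto
      then obtain l l' where "1 \<le> l" "l < l'" "l' \<le> n" "w = e l"
        unfolding index_prec_def by blast
      then have l: "l \<in> {1..n}" "w = e l" by auto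
      then have "l < j" using *(3) index_prec_iff[OF inj _ j(1)] by blast
      with l * show "\<exists>l. 1 \<le> l \<and> l < j \<and> w = e l \<and> e l \<in> F \<and> e l \<in> neighbours E L (e j)" by auto
    next
      assume "\<exists>l. 1 \<le> l \<and> l < j \<and> w = e l \<and> e l \<in> F \<and> e l \<in> neighbours E L (e j)"
      then obtain l where l: "1 \<le> l" "l < j" "w = e l" "e l \<in> F" "e l \<in> neighbours E L (e j)"
        by blast
      then show "(e j, w) \<in> graph_arcs E L (index_prec e n) F"
        using graph_edges_iff[OF face_subset[OF F] j(2)] index_prec_iff[OF inj _ j(1), of l] j(1)
        unfolding graph_arcs_def by auto
    qed
    show ?thesis using j(2) unfolding is_sink_def arc by blast
  qed
  have first_sink: "\<exists>k\<in>{1..n}. e k \<in> F \<and> (\<forall>l. 1 \<le> l \<and> l < k \<longrightarrow> e l \<notin> F)"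
    if F: "face E L F" "F \<noteq> {}" for F
  proof -
    obtain i where i: "i \<in> {1..n}" "e i \<in> F" using F face_subset img by blast
    define k where "k = (LEAST k. k \<in> {1..n} \<and> e k \<in> F)"
    have k: "k \<in> {1..n} \<and> e k \<in> F" unfolding k_def using i by (intro LeastI) blast
    have "e l \<notin> F" if "1 \<le> l" "l < k" for l
    proof
      assume "e l \<in> F"
      then have "k \<le> l" unfolding k_def using that k by (intro Least_le) (auto simp: k_def)
      then show False using that by simp
    qed
    then show ?thesis using k by blast
  qed
  show ?thesis
  proof
    assume K: "K_ordering E L (index_prec e n)"
    show ?R
    proof (intro allI impI)
      fix F i j assume *: "face E L F \<and> 1 \<le> i \<and> i < j \<and> j \<le> n \<and> e i \<in> F \<and> e j \<in> F"
      then have F: "face E L F" "F \<noteq> {}" by auto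
      obtain k where k: "k \<in> {1..n}" "e k \<in> F" "\<forall>l. 1 \<le> l \<and> l < k \<longrightarrow> e l \<notin> F"
        using first_sink[OF F] by blast
      \<comment> \<open>The vertex \<open>e i\<close> precedes \<open>e j\<close> in
        \<open>F\<close>, so \<open>e j\<close> is not the first one; uniqueness of the sink
        \<open>e k\<close> then gives \<open>e j\<close> an earlier neighbour.\<close>
      have "k \<noteq> j" using k * by blast
      then have "e k \<noteq> e j" using inj_onD[OF inj, of k j] k(1) * by auto
      moreover have "is_sink F (graph_arcs E L (index_prec e n) F) (e k)"
        using sink[OF F(1) k(1,2)] k(3) by blast
      ultimately have "\<not> is_sink F (graph_arcs E L (index_prec e n) F) (e j)"
        using K F unfolding K_ordering_def by blast
      then show "\<exists>l. 1 \<le> l \<and> l < j \<and> e l \<in> F \<and> e l \<in> neighbours E L (e j)"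
        using sink[OF F(1), of j] * by auto
    qed
  next
    assume R: ?R
    show "K_ordering E L (index_prec e n)"
      unfolding K_ordering_def
    proof (intro allI impI)
      fix F assume "face E L F \<and> F \<noteq> {}"
      then have F: "face E L F" "F \<noteq> {}" by auto
      obtain k where k: "k \<in> {1..n}" "e k \<in> F" "\<forall>l. 1 \<le> l \<and> l < k \<longrightarrow> e l \<notin> F"
        using first_sink[OF F] by blast
      show "\<exists>!v. is_sink F (graph_arcs E L (index_prec e n) F) v"
      proof (rule ex1I[of _ "e k"])
        show "is_sink F (graph_arcs E L (index_prec e n) F) (e k)"
          using sink[OF F(1) k(1,2)] k(3) by blast
      next
        fix v assume v: "is_sink F (graph_arcs E L (index_prec e n) F) v"
        then have "v \<in> F" unfolding is_sink_def by blast
        then obtain j where j: "j \<in> {1..n}" "v = e j" using face_subset[OF F(1)] img by blast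
        \<comment> \<open>A sink after the first vertex is refuted by \<open>R\<close> applied to
          the pair \<open>k\<close>, \<open>j\<close>.\<close>
        have "\<not> k < j"
        proof
          assume "k < j"
          then have "\<exists>l. 1 \<le> l \<and> l < j \<and> e l \<in> F \<and> e l \<in> neighbours E L (e j)"
            using R[rule_format, of F k j] F k j \<open>v \<in> F\<close> by auto
          then show False using sink[OF F(1) j(1)] v j(2) \<open>v \<in> F\<close> by blast
        qed
        moreover have "\<not> j < k" using k(3) j \<open>v \<in> F\<close> by auto
        ultimately show "v = e k" using j(2) by simp
      qed
    qed
  qed
qed

theorem theorem2p3:
  fixes E :: "'a set" and L :: "('a \<Rightarrow> int) set" and e :: "nat \<Rightarrow> 'a" and n :: nat
  assumes "matroid_polytope E L"
    and "simple_om E L"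
    and "bij_betw e {1..n} E"
  shows "K_ordering E L (index_prec e n) \<longleftrightarrow> tope_boundary_shelling E L e n"
proof -
  interpret oriented_matroid E L using assms(1) unfolding matroid_polytope_def by blast
  interpret simple_polytope E L
    using assms(1,2) unfolding matroid_polytope_def by unfold_locales blast+
  have inE: "e i \<in> E" if "1 \<le> i" "i \<le> n" for i
    using assms(3) that unfolding bij_betw_def by auto
  have edge: "card (common_facets E L (e l) (e j)) = om_rank E L E - 2 \<longleftrightarrow>
      e l \<in> neighbours E L (e j)" if "1 \<le> l" "l < j" "j \<le> n" for l j
  proof -
    have "inj_on e {1..n}" using assms(3) unfolding bij_betw_def by blast
    then have "e l \<noteq> e j" using that by (auto dest: inj_onD)
    then show ?thesis using common_facets_card_iff inE that by simp
  qed
  show ?thesis unfolding K_ordering_iff[OF assms(3)] tope_boundary_shelling_def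
  proof (intro iffI allI impI)
    fix i j
    assume K: "\<forall>F i j. face E L F \<and> 1 \<le> i \<and> i < j \<and> j \<le> n \<and> e i \<in> F \<and> e j \<in> F \<longrightarrow>
      (\<exists>l. 1 \<le> l \<and> l < j \<and> e l \<in> F \<and> e l \<in> neighbours E L (e j))"
      and ij: "1 \<le> i \<and> i < j \<and> j \<le> n"
    \<comment> \<open>In this smallest face, membership of \<open>e l\<close> is the same as the
      inclusion of common facets demanded by the shelling condition.\<close>
    let ?F = "E \<inter> \<Inter>(common_facets E L (e i) (e j))"
    have "face E L ?F" using face_common_facets inE ij by simp
    moreover have "e i \<in> ?F" "e j \<in> ?F" using inE ij unfolding common_facets_def by auto
    ultimately obtain l where l: "1 \<le> l" "l < j" "e l \<in> ?F" "e l \<in> neighbours E L (e j)"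
      using K[rule_format, of ?F i j] ij by blast
    have "common_facets E L (e i) (e j) \<subseteq> common_facets E L (e l) (e j)"
      using l(3) unfolding common_facets_def by blast
    then show "\<exists>l. 1 \<le> l \<and> l < j \<and>
        card (common_facets E L (e l) (e j)) = om_rank E L E - 2 \<and>
        common_facets E L (e i) (e j) \<subseteq> common_facets E L (e l) (e j)"
      using l edge[OF l(1,2)] ij by blast
  next
    fix F i j
    assume S: "\<forall>i j. 1 \<le> i \<and> i < j \<and> j \<le> n \<longrightarrow>
        (\<exists>l. 1 \<le> l \<and> l < j \<and>
             card (common_facets E L (e l) (e j)) = om_rank E L E - 2 \<and>
             common_facets E L (e i) (e j) \<subseteq> common_facets E L (e l) (e j))"
      and F: "face E L F \<and> 1 \<le> i \<and> i < j \<and> j \<le> n \<and> e i \<in> F \<and> e j \<in> F"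
    then obtain l where l: "1 \<le> l" "l < j"
      "card (common_facets E L (e l) (e j)) = om_rank E L E - 2"
      "common_facets E L (e i) (e j) \<subseteq> common_facets E L (e l) (e j)" by blast
    \<comment> \<open>The index \<open>l\<close> depends only on \<open>i\<close> and
      \<open>j\<close>, yet the inclusion of common facets puts \<open>e l\<close> in every face
      containing both vertices.\<close>
    have "e l \<in> F" using smallest_face_in_facets[of F "e i" "e j" "e l"] F l inE[of l] by simp
    then show "\<exists>l. 1 \<le> l \<and> l < j \<and> e l \<in> F \<and> e l \<in> neighbours E L (e j)"
      using l edge[OF l(1,2)] F by blast
  qed
qed

end
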